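(* Let $(X,d)$ be a pointed metric space and let $((x_i,y_i))_{i\in I}$ be a Lipschitz interpolating family in $\widetilde X$ for $\mathrm{Lip}_0(X)$ whose Lipschitz interpolation constant is $1$. Then there exists a Beurling set of functions in $\mathrm{Lip}_0(X)$ for $((x_i,y_i))_{i\in I}$, i.e. a family $(f_i)_{i\in I}$ of functions $X\to\mathbb R$ with $f_i(0)=0$, $(f_i(x_j)-f_i(y_j))/d(x_j,y_j)=\delta_{ij}$ for all $i,j\in I$, and $\sup_{(x,y)\in\widetilde X}\sum_{i\in I}|f_i(x)-f_i(y)|/d(x,y)\leq 1$.
   Context: All spaces are real. $(X,d)$ is a metric space with base point $0$, $\widetilde{X}=\{(x,y)\in X\times X: x\neq y\}$. $\mathrm{Lip}_0(X)$ is the Banach space of Lipschitz $f:X\to\mathbb{R}$ with $f(0)=0$, normed by $\|f\|=\sup_{(x,y)\in\widetilde X}|f(x)-f(y)|/d(x,y)$. For a family $((x_i,y_i))_{i\in I}$ in $\widetilde X$, $T:\mathrm{Lip}_0(X)\to\ell_\infty(I)$, $T(f)=\big((f(x_i)-f(y_i))/d(x_i,y_i)\big)_{i\in I}$; the family is Lipschitz interpolating for $\mathrm{Lip}_0(X)$ if $T$ is surjective, and then its Lipschitz interpolation constant is $\inf\{K\geq 1: \forall \alpha\in\ell_\infty(I), \|\alpha\|_\infty\le1,\ \exists f\in\mathrm{Lip}_0(X),\ \|f\|\le K,\ T(f)=\alpha\}$. *)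

theory Defs
  imports "HOL-Analysis.Analysis"
begin

definition Lip0 :: "'a::metric_space \<Rightarrow> ('a \<Rightarrow> real) set" where
  "Lip0 z = {f. f z = 0 \<and> (\<exists>K. \<forall>x y. \<bar>f x - f y\<bar> \<le> K * dist x y)}"

text \<open>Lipschitz norm: sup over pairs x \<noteq> y of the difference quotient (0 if X has one point).\<close>
definition lip_norm :: "('a::metric_space \<Rightarrow> real) \<Rightarrow> real" where
  "lip_norm f = Sup (insert 0 {\<bar>f x - f y\<bar> / dist x y | x y. x \<noteq> y})"

definition lip_T :: "('i \<Rightarrow> 'a::metric_space) \<Rightarrow> ('i \<Rightarrow> 'a) \<Rightarrow> ('a \<Rightarrow> real) \<Rightarrow> 'i \<Rightarrow> real" where
  "lip_T xs ys f = (\<lambda>i. (f (xs i) - f (ys i)) / dist (xs i) (ys i))"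

definition linf :: "'i set \<Rightarrow> ('i \<Rightarrow> real) set" where
  "linf I = {\<alpha>. \<exists>B. \<forall>i\<in>I. \<bar>\<alpha> i\<bar> \<le> B}"

definition lip_interpolating ::
  "'a::metric_space \<Rightarrow> 'i set \<Rightarrow> ('i \<Rightarrow> 'a) \<Rightarrow> ('i \<Rightarrow> 'a) \<Rightarrow> bool" where
  "lip_interpolating z I xs ys \<longleftrightarrow>
     (\<forall>i\<in>I. xs i \<noteq> ys i) \<and>
     (\<forall>\<alpha>\<in>linf I. \<exists>f\<in>Lip0 z. \<forall>i\<in>I. lip_T xs ys f i = \<alpha> i)"

definition lip_interp_const ::
  "'a::metric_space \<Rightarrow> 'i set \<Rightarrow> ('i \<Rightarrow> 'a) \<Rightarrow> ('i \<Rightarrow> 'a) \<Rightarrow> real" where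
  "lip_interp_const z I xs ys = Inf {K. K \<ge> 1 \<and>
     (\<forall>\<alpha>. (\<forall>i\<in>I. \<bar>\<alpha> i\<bar> \<le> 1) \<longrightarrow>
        (\<exists>f\<in>Lip0 z. lip_norm f \<le> K \<and> (\<forall>i\<in>I. lip_T xs ys f i = \<alpha> i)))}"

end

theory Submission
  imports Defs
begin

text \<open>
  Regard each pair \<open>(x\<^sub>i, y\<^sub>i)\<close> as an edge of weight \<open>- d(x\<^sub>i, y\<^sub>i)\<close>, and each pair of points
  \<open>(u, v)\<close> as an edge of weight \<open>d(u, v)\<close>. Orienting an Eulerian edge set and interpolating the
  resulting signs shows that interpolation constant 1 makes these weights conservative: every
  edge set with even degrees has nonnegative weight. A Beurling family is then a fractional packing
  of cuts, each crossed by exactly one negative edge, that exhausts the negative edges, as in the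
  duality of Edmonds and Johnson between T-joins and T-cuts. For finite data take a packing of
  maximal total size. If a negative edge survives in the residual weights, an argument of
  Sebo applies: around a vertex whose signed distance from a base point is minimal there is
  a cut that can still be shrunk without losing conservativity, contradicting maximality. Infinite
  families and spaces follow by Tychonoff's theorem.
\<close>

section \<open>Parity and weight of symmetric differences\<close>

lemma odd_card_sym_diff:
  assumes "finite A" "finite B"
  shows "odd (card (sym_diff A B)) \<longleftrightarrow> odd (card A) \<noteq> odd (card B)"
proof -
  have "card (sym_diff A B) = card (A - B) + card (B - A)"
    using assms by (intro card_Un_disjoint) auto
  moreover have "card A = card (A - B) + card (A \<inter> B)" "card B = card (B - A) + card (A \<inter> B)"
    using assms by (metis Int_commute add.commute card_Int_Diff)+
  ultimately show ?thesis by auto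
qed

lemma sum_sym_diff:
  fixes c :: "'e \<Rightarrow> real"
  assumes "finite A" "finite B"
  shows "sum c (sym_diff A B) = sum c A + sum c B - 2 * sum c (A \<inter> B)"
proof -
  have "sum c (sym_diff A B) = sum c (A - B) + sum c (B - A)"
    using assms by (intro sum.union_disjoint) auto
  moreover have "sum c A = sum c (A - B) + sum c (A \<inter> B)" "sum c B = sum c (B - A) + sum c (A \<inter> B)"
    using assms by (metis Int_commute add.commute sum.Int_Diff)+
  ultimately show ?thesis by simp
qed

section \<open>Joins and even edge sets\<close>

text \<open>A multigraph is given by its end maps \<open>src\<close> and \<open>tgt\<close>. Boundaries modulo 2 are expressed
  through parities of all cuts, which makes them additive under symmetric difference.\<close>

locale multigraph =
  fixes src tgt :: "'e \<Rightarrow> 'v"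
begin

definition crosses :: "'v set \<Rightarrow> 'e \<Rightarrow> bool" where
  "crosses S e \<longleftrightarrow> (src e \<in> S) \<noteq> (tgt e \<in> S)"

definition even_set :: "'e set \<Rightarrow> bool" where
  "even_set K \<longleftrightarrow> (\<forall>S. even (card {e \<in> K. crosses S e}))"

text \<open>For finite \<open>K\<close> these are the T-joins with T = {u, v}, with no odd vertex if
  \<open>u = v\<close>. Besides a path from \<open>u\<close> to \<open>v\<close>, such a set may
  contain cycles.\<close>

definition join :: "'v \<Rightarrow> 'v \<Rightarrow> 'e set \<Rightarrow> bool" where
  "join u v K \<longleftrightarrow> (\<forall>S. odd (card {e \<in> K. crosses S e}) \<longleftrightarrow> (u \<in> S) \<noteq> (v \<in> S))"

lemma odd_crossing_sym_diff:
  assumes "finite K" "finite L"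
  shows "odd (card {e \<in> sym_diff K L. crosses S e}) \<longleftrightarrow>
    odd (card {e \<in> K. crosses S e}) \<noteq> odd (card {e \<in> L. crosses S e})"
proof -
  have "{e \<in> sym_diff K L. crosses S e} =
      sym_diff {e \<in> K. crosses S e} {e \<in> L. crosses S e}"
    by auto
  then show ?thesis
    using odd_card_sym_diff[of "{e \<in> K. crosses S e}" "{e \<in> L. crosses S e}"] assms by simp
qed

lemma join_commute: "join u v K \<longleftrightarrow> join v u K"
  unfolding join_def by auto

lemma join_refl_iff: "join u u K \<longleftrightarrow> even_set K"
  unfolding join_def even_set_def by auto

lemma join_empty: "join u u {}"
  unfolding join_def by simp

lemma join_edge: "join (src e) (tgt e) {e}"
proof -
  have "{f \<in> {e}. crosses S f} = (if crosses S e then {e} else {})" for S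
    by auto
  then show ?thesis
    unfolding join_def by (simp add: crosses_def)
qed

lemma join_trans:
  assumes "join u v K" "join v w L" "finite K" "finite L"
  shows "join u w (sym_diff K L)"
  using assms unfolding join_def by (simp only: odd_crossing_sym_diff) blast

lemma join_even_sym_diff:
  assumes "join u v K" "even_set C" "finite K" "finite C"
  shows "join u v (sym_diff K C)"
  using assms join_trans join_refl_iff by blast

lemma even_set_sym_diff:
  assumes "even_set K" "even_set C" "finite K" "finite C"
  shows "even_set (sym_diff K C)"
  using assms join_even_sym_diff join_refl_iff by blast

lemma crosses_cases:
  assumes "crosses S e"
  obtains s t where "s \<in> S" "t \<notin> S" "join s t {e}" "{src e, tgt e} = {s, t}"
proof (cases "src e \<in> S")
  case True
  then show thesis
    using that[of "src e" "tgt e"] join_edge[of e] assms unfolding crosses_def by blast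
next
  case False
  then show thesis
    using that[of "tgt e" "src e"] join_edge[of e] join_commute assms unfolding crosses_def by blast
qed

text \<open>A substitute for cutting a walk at its first visit to \<open>S\<close>. The set
  \<open>R\<close> holds the vertices outside \<open>S\<close> that are reached inside
  \<open>K\<close> without crossing \<open>S\<close>. By parity some edge of \<open>K\<close> leaves
  \<open>R\<close>, and its far end lies in \<open>S\<close>, since otherwise it would belong to
  \<open>R\<close>.\<close>

lemma join_first_hit:
  assumes K: "finite K" "join z s K" and S: "z \<notin> S" "s \<in> S"
  obtains K' s' e where "K' \<subseteq> K" "s' \<in> S" "join z s' K'" "{f \<in> K'. crosses S f} = {e}"
proof -
  define R where "R = {u. u \<notin> S \<and> (\<exists>L\<subseteq>K. join z u L \<and> (\<forall>f\<in>L. \<not> crosses S f))}"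
  have "z \<in> R"
    unfolding R_def using S join_empty by blast
  moreover have "s \<notin> R"
    unfolding R_def using S by blast
  ultimately have "odd (card {f \<in> K. crosses R f})"
    using K unfolding join_def by blast
  then have "{f \<in> K. crosses R f} \<noteq> {}"
    by (metis card.empty even_zero)
  then obtain e where e: "e \<in> K" "crosses R e"
    by blast
  obtain u t where ut: "u \<in> R" "t \<notin> R" "join u t {e}" and ends: "{src e, tgt e} = {u, t}"
    using crosses_cases[OF e(2)] .
  obtain L where L: "L \<subseteq> K" "join z u L" "\<forall>f\<in>L. \<not> crosses S f"
    using ut(1) unfolding R_def by blast
  have j: "join z t (sym_diff L {e})"
    using join_trans[OF L(2) ut(3)] finite_subset[OF L(1) K(1)] by simp
  have sub: "sym_diff L {e} \<subseteq> K"
    using L(1) e(1) by blast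
  have uS: "u \<notin> S"
    using ut(1) unfolding R_def by blast
  show thesis
  proof (cases "t \<in> S")
    case True
    then have "crosses S e"
      using ends uS unfolding crosses_def by (auto simp: doubleton_eq_iff)
    then have "{f \<in> sym_diff L {e}. crosses S f} = {e}"
      using L(3) by auto
    then show thesis
      using that sub True j by blast
  next
    case False
    then have "\<not> crosses S e"
      using ends uS unfolding crosses_def by (auto simp: doubleton_eq_iff)
    then have "\<forall>f\<in>sym_diff L {e}. \<not> crosses S f"
      using L(3) by auto
    then have "t \<in> R"
      unfolding R_def using j sub False by blast
    then show thesis
      using ut(2) by blast
  qed
qed

end

text \<open>An Eulerian orientation, obtained by merging two edges at a common vertex into one.\<close>

lemma even_set_orientation:
  fixes src tgt :: "'e \<Rightarrow> 'v"
  assumes "finite K" "multigraph.even_set src tgt K"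
  shows "\<exists>\<sigma>::'e \<Rightarrow> real. (\<forall>e. \<bar>\<sigma> e\<bar> = 1) \<and>
    (\<forall>h. (\<Sum>e\<in>K. \<sigma> e * (h (src e) - h (tgt e))) = 0)"
  using assms
proof (induction "card K" arbitrary: K src tgt rule: less_induct)
  case less
  show ?case
  proof (cases "\<forall>e\<in>K. src e = tgt e")
    case True
    then show ?thesis
      by (intro exI[of _ "\<lambda>_. 1"]) auto
  next
    case False
    then obtain e where e: "e \<in> K" "src e \<noteq> tgt e"
      by blast
    define v p where "v = src e" and "p = tgt e"
    interpret G: multigraph src tgt .
    have "crs": "G.crosses {v} e"
      using e unfolding G.crosses_def v_def by auto
    have "even (card {f \<in> K. G.crosses {v} f})"
      using less.prems unfolding G.even_set_def by blast
    then have "{f \<in> K. G.crosses {v} f} \<noteq> {e}"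
      by (metis card_1_singleton_iff odd_one One_nat_def)
    then obtain e' where e': "e' \<in> K" "e' \<noteq> e" "G.crosses {v} e'"
      using e(1) crs by blast
    define \<tau> :: real where "\<tau> = (if src e' = v then 1 else -1)"
    define q where "q = (if src e' = v then tgt e' else src e')"
    define src' tgt' where "src' = src(e := p)" and "tgt' = tgt(e := q)"
    interpret H: multigraph src' tgt' .
    let ?K = "K - {e'}"
    \<comment> \<open>The merged edge crosses a cut exactly when one but not both of
      \<open>e\<close>, \<open>e'\<close> does, so all cut parities survive.\<close>
    have cr: "H.crosses S e \<longleftrightarrow> G.crosses S e \<noteq> G.crosses S e'" for S
      using e' unfolding multigraph.crosses_def src'_def tgt'_def p_def q_def v_def by auto
    have cr': "H.crosses S f \<longleftrightarrow> G.crosses S f" if "f \<noteq> e" for S f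
      using that unfolding multigraph.crosses_def src'_def tgt'_def by auto
    have "even (card {f \<in> ?K. H.crosses S f})" for S
    proof -
      let ?B = "{f \<in> K - {e, e'}. G.crosses S f}"
      have fin: "finite ?B"
        using less.prems(1) by auto
      have "{f \<in> K. G.crosses S f} = ?B \<union> (if G.crosses S e then {e} else {}) \<union>
          (if G.crosses S e' then {e'} else {})"
        using e e' by auto
      moreover have "{f \<in> K - {e, e'}. H.crosses S f} = ?B"
        using cr' by auto
      then have "{f \<in> ?K. H.crosses S f} = ?B \<union> (if H.crosses S e then {e} else {})"
        using e e' by auto
      moreover have "even (card {f \<in> K. G.crosses S f})"
        using less.prems unfolding G.even_set_def by blast
      ultimately show ?thesis
        using fin e'(2) cr[of S] by (cases "G.crosses S e"; cases "G.crosses S e'") simp_all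
    qed
    then have "H.even_set ?K"
      unfolding H.even_set_def by blast
    moreover have "card ?K < card K"
      using less.prems(1) e'(1) by (meson card_Diff1_less)
    ultimately obtain \<sigma> :: "'e \<Rightarrow> real" where \<sigma>: "\<forall>f. \<bar>\<sigma> f\<bar> = 1"
      "\<And>h. (\<Sum>f\<in>?K. \<sigma> f * (h (src' f) - h (tgt' f))) = 0"
      using less.hyps[of ?K src' tgt'] less.prems(1) by auto
    \<comment> \<open>Both parts inherit the direction of the merged edge: \<open>h p - h q\<close>
      splits into \<open>- (h v - h p)\<close> and \<open>h v - h q\<close>.\<close>
    define \<sigma>' where "\<sigma>' = \<sigma>(e := - \<sigma> e, e' := \<tau> * \<sigma> e)"
    have "(\<Sum>f\<in>K. \<sigma>' f * (h (src f) - h (tgt f))) = 0" for h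
    proof -
      let ?r = "\<Sum>f\<in>K - {e, e'}. \<sigma> f * (h (src f) - h (tgt f))"
      have "(\<Sum>f\<in>K - {e', e}. \<sigma> f * (h (src' f) - h (tgt' f))) = ?r"
        by (rule sum.cong) (auto simp: src'_def tgt'_def)
      then have 1: "\<sigma> e * (h p - h q) + ?r = 0"
        using \<sigma>(2)[of h] less.prems(1) e e' sum.remove[of ?K e "\<lambda>f. \<sigma> f * (h (src' f) - h (tgt' f))"]
        by (simp add: src'_def tgt'_def Diff_insert2[symmetric])
      have "(\<Sum>f\<in>K - {e} - {e'}. \<sigma>' f * (h (src f) - h (tgt f))) = ?r"
        by (rule sum.cong) (auto simp: \<sigma>'_def)
      then have "(\<Sum>f\<in>K. \<sigma>' f * (h (src f) - h (tgt f))) =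
          - \<sigma> e * (h v - h p) + (\<tau> * \<sigma> e * (h (src e') - h (tgt e')) + ?r)"
        using less.prems(1) e e' sum.remove[of K e "\<lambda>f. \<sigma>' f * (h (src f) - h (tgt f))"]
          sum.remove[of "K - {e}" e' "\<lambda>f. \<sigma>' f * (h (src f) - h (tgt f))"]
        by (simp add: \<sigma>'_def v_def p_def)
      moreover have "\<tau> * \<sigma> e * (h (src e') - h (tgt e')) = \<sigma> e * (h v - h q)"
        using e'(3) unfolding G.crosses_def \<tau>_def q_def by (auto simp: algebra_simps)
      ultimately show ?thesis
        using 1 by (simp add: algebra_simps)
    qed
    moreover have "\<forall>f. \<bar>\<sigma>' f\<bar> = 1"
      using \<sigma>(1) unfolding \<sigma>'_def \<tau>_def by (simp add: abs_mult)
    ultimately show ?thesis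
      by blast
  qed
qed

section \<open>Conservative weightings\<close>

locale conservative = multigraph src tgt
  for src tgt :: "'e \<Rightarrow> 'v" +
  fixes E :: "'e set" and c :: "'e \<Rightarrow> real"
  assumes fin_E: "finite E"
    and sum_even_nonneg: "\<And>C. C \<subseteq> E \<Longrightarrow> even_set C \<Longrightarrow> 0 \<le> sum c C"
begin

lemma fin_sub: "K \<subseteq> E \<Longrightarrow> finite K"
  using fin_E finite_subset by blast

lemma sum_sym_diff_null:
  assumes "K \<subseteq> E" "Z \<subseteq> E" "\<forall>e\<in>Z. c e = 0"
  shows "sum c (sym_diff K Z) = sum c K"
  using sum_sym_diff[of K Z c] assms fin_sub by simp

text \<open>The connected component of \<open>b\<close> in the graph of edges of weight zero. Moving
  inside it is free, and every edge of \<open>E\<close> leaving it has nonzero weight.\<close>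

definition cluster :: "'v \<Rightarrow> 'v set" where
  "cluster b = {s. \<exists>Z\<subseteq>E. (\<forall>e\<in>Z. c e = 0) \<and> join b s Z}"

lemma cluster_self: "b \<in> cluster b"
  unfolding cluster_def using join_empty by blast

lemma cluster_join:
  assumes "s \<in> cluster b" "t \<in> cluster b"
  obtains Z where "Z \<subseteq> E" "\<forall>e\<in>Z. c e = 0" "join s t Z"
proof -
  obtain Y where Y: "Y \<subseteq> E" "\<forall>e\<in>Y. c e = 0" "join b s Y"
    using assms(1) unfolding cluster_def by blast
  obtain Z where Z: "Z \<subseteq> E" "\<forall>e\<in>Z. c e = 0" "join b t Z"
    using assms(2) unfolding cluster_def by blast
  have "join s t (sym_diff Y Z)"
    using join_trans[of s b Y t Z] Y Z fin_sub join_commute by blast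
  then show thesis
    using that[of "sym_diff Y Z"] Y Z by blast
qed

lemma null_not_crosses_cluster:
  assumes "e \<in> E" "c e = 0"
  shows "\<not> crosses (cluster b) e"
proof
  assume "crosses (cluster b) e"
  then obtain s t where st: "s \<in> cluster b" "t \<notin> cluster b" "join s t {e}"
    using crosses_cases by blast
  obtain Z where Z: "Z \<subseteq> E" "\<forall>e\<in>Z. c e = 0" "join b s Z"
    using st(1) unfolding cluster_def by blast
  have "join b t (sym_diff Z {e})"
    using join_trans[OF Z(3) st(3)] fin_sub[OF Z(1)] by simp
  moreover have "sym_diff Z {e} \<subseteq> E" "\<forall>f\<in>sym_diff Z {e}. c f = 0"
    using Z assms by auto
  ultimately have "t \<in> cluster b"
    unfolding cluster_def mem_Collect_eq by (intro exI[of _ "sym_diff Z {e}"] conjI)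
  then show False
    using st(2) by blast
qed

end

section \<open>The cut around a nearest vertex\<close>

text \<open>The base point is \<open>z\<close>, and \<open>b\<close> is a vertex nearest to \<open>z\<close> for the signed weights.\<close>

locale nearest = conservative +
  fixes z b :: 'b and m :: real and K0 :: "'a set"
  assumes minimal: "\<And>K v. K \<subseteq> E \<Longrightarrow> join z v K \<Longrightarrow> m \<le> sum c K"
    and K0: "K0 \<subseteq> E" "join z b K0" "sum c K0 = m"
    and m_neg: "m < 0"
begin

text \<open>Otherwise a null join would close \<open>K0\<close> to an even set of weight
  \<open>m < 0\<close>.\<close>

lemma z_notin_cluster: "z \<notin> cluster b"
proof
  assume "z \<in> cluster b"
  then obtain Z where Z: "Z \<subseteq> E" "\<forall>e\<in>Z. c e = 0" "join b z Z"
    unfolding cluster_def by blast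
  have "join z z (sym_diff K0 Z)"
    using join_trans K0 Z fin_sub by blast
  moreover have "sym_diff K0 Z \<subseteq> E"
    using K0 Z by blast
  ultimately have "0 \<le> sum c (sym_diff K0 Z)"
    using sum_even_nonneg join_refl_iff by blast
  then show False
    using sum_sym_diff_null[OF K0(1) Z(1,2)] K0(3) m_neg by simp
qed

text \<open>Let \<open>K\<close> be the part of \<open>K0\<close> up to the first arrival in the
  cluster. The rest of \<open>K0\<close>, closed up by null edges, is an even set and so has
  nonnegative weight. Hence \<open>K\<close> weighs at most \<open>m\<close>, and minimality gives
  equality.\<close>

lemma optimal_first_hit:
  obtains K s e where "K \<subseteq> E" "s \<in> cluster b" "join z s K" "sum c K = m"
    "{f \<in> K. crosses (cluster b) f} = {e}"
proof -
  obtain K s e where K: "K \<subseteq> K0" "s \<in> cluster b" "join z s K"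
    "{f \<in> K. crosses (cluster b) f} = {e}"
    using join_first_hit[OF fin_sub[OF K0(1)] K0(2) z_notin_cluster cluster_self] by metis
  have KE: "K \<subseteq> E"
    using K K0 by blast
  obtain Z where Z: "Z \<subseteq> E" "\<forall>e\<in>Z. c e = 0" "join b s Z"
    using K(2) unfolding cluster_def by blast
  have "join b s (sym_diff K0 K)"
    using join_trans[of b z K0 s K] K0 K(3) KE fin_sub join_commute by blast
  then have "join s s (sym_diff (sym_diff K0 K) Z)"
    using join_trans[of s b "sym_diff K0 K" s Z] Z fin_sub[OF KE] fin_sub[OF K0(1)]
      fin_sub[OF Z(1)] join_commute by blast
  moreover have sub: "sym_diff K0 K \<subseteq> E"
    using KE K0 by blast
  ultimately have "0 \<le> sum c (sym_diff (sym_diff K0 K) Z)"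
    using sum_even_nonneg Z(1) join_refl_iff by (meson Diff_subset Un_least subset_trans)
  also have "\<dots> = sum c (sym_diff K0 K)"
    using sum_sym_diff_null[OF sub Z(1,2)] .
  also have "sym_diff K0 K = K0 - K"
    using K(1) by blast
  also have "sum c (K0 - K) = m - sum c K"
    using K(1) K0 fin_sub by (metis sum_diff)
  finally have "sum c K = m"
    using minimal[OF KE K(3)] by simp
  then show thesis
    using that KE K by blast
qed

text \<open>A negative crossing edge missing from the optimal join \<open>K\<close> could be
  appended to it, after a free move to its inner end, giving a join lighter than \<open>m\<close>.
  So all such edges lie in \<open>K\<close>, which has only one crossing edge.\<close>

lemma unique_negative_crossing:
  assumes "e \<in> E" "c e < 0" "crosses (cluster b) e"
    and "e' \<in> E" "c e' < 0" "crosses (cluster b) e'"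
  shows "e = e'"
proof -
  obtain K s g where K: "K \<subseteq> E" "s \<in> cluster b" "join z s K" "sum c K = m"
    "{f \<in> K. crosses (cluster b) f} = {g}"
    using optimal_first_hit by metis
  have "f \<in> K" if f: "f \<in> E" "c f < 0" "crosses (cluster b) f" for f
  proof (rule ccontr)
    assume "f \<notin> K"
    obtain u t where ut: "u \<in> cluster b" "t \<notin> cluster b" "join u t {f}"
      using crosses_cases[OF f(3)] by metis
    obtain Z where Z: "Z \<subseteq> E" "\<forall>e\<in>Z. c e = 0" "join s u Z"
      using cluster_join[OF K(2) ut(1)] .
    let ?L = "sym_diff K Z"
    have L: "join z u ?L" "?L \<subseteq> E"
      using join_trans[OF K(3) Z(3)] K Z fin_sub by auto
    have "f \<notin> ?L"
      using \<open>f \<notin> K\<close> Z(2) f(2) by auto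
    then have eq: "sym_diff ?L {f} = insert f ?L"
      by auto
    have "join z t (insert f ?L)"
      using join_trans[OF L(1) ut(3) fin_sub[OF L(2)]] unfolding eq by simp
    then have "m \<le> sum c (insert f ?L)"
      using minimal L(2) f(1) by (meson insert_subset)
    also have "\<dots> = c f + m"
      using \<open>f \<notin> ?L\<close> fin_sub[OF L(2)] sum_sym_diff_null[OF K(1) Z(1,2)] K(4) by simp
    finally show False
      using f(2) by simp
  qed
  then have "e \<in> {f \<in> K. crosses (cluster b) f}" "e' \<in> {f \<in> K. crosses (cluster b) f}"
    using assms by auto
  then show ?thesis
    unfolding K(5) by simp
qed

text \<open>The witness is the only edge of the optimal join \<open>K\<close> that crosses. If it
  were positive, a free move to its inner end followed by its deletion would give a join lighter
  than \<open>m\<close>.\<close>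

lemma negative_crossing:
  obtains e where "e \<in> E" "c e < 0" "crosses (cluster b) e"
proof -
  obtain K s e where K: "K \<subseteq> E" "s \<in> cluster b" "join z s K" "sum c K = m"
    "{f \<in> K. crosses (cluster b) f} = {e}"
    using optimal_first_hit by metis
  have e: "e \<in> K" "crosses (cluster b) e"
    using K(5) by auto
  have "c e < 0"
  proof (rule ccontr)
    assume "\<not> c e < 0"
    then have pos: "c e > 0"
      using null_not_crosses_cluster e K(1) by force
    obtain u t where ut: "u \<in> cluster b" "t \<notin> cluster b" "join u t {e}"
      using crosses_cases[OF e(2)] by metis
    obtain Z where Z: "Z \<subseteq> E" "\<forall>e\<in>Z. c e = 0" "join s u Z"
      using cluster_join[OF K(2) ut(1)] .
    let ?L = "sym_diff K Z"
    have L: "join z u ?L" "?L \<subseteq> E"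
      using join_trans[OF K(3) Z(3)] K Z fin_sub by auto
    have eL: "e \<in> ?L"
      using e(1) Z(2) pos by auto
    then have eq: "sym_diff ?L {e} = ?L - {e}"
      by auto
    have "join z t (?L - {e})"
      using join_trans[OF L(1) ut(3) fin_sub[OF L(2)]] unfolding eq by simp
    then have "m \<le> sum c (?L - {e})"
      using minimal L(2) by (meson Diff_subset subset_trans)
    also have "\<dots> = m - c e"
      using eL fin_sub[OF L(2)] sum_sym_diff_null[OF K(1) Z(1,2)] K(4)
      by (simp add: sum_diff1)
    finally show False
      using pos by simp
  qed
  then show thesis
    using that e K(1) by blast
qed

text \<open>Since \<open>C\<close> has weight zero, the flipped weight of \<open>K\<close> is the
  old weight of \<open>sym_diff K C\<close>. Adding \<open>C\<close> preserves even sets and joins,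
  so \<open>b\<close> and \<open>m\<close> stay the same and \<open>K0\<close> is replaced by
  \<open>sym_diff K0 C\<close>.\<close>

lemma nearest_flip:
  assumes C: "C \<subseteq> E" "even_set C" "sum c C = 0"
  defines "c' \<equiv> \<lambda>e. if e \<in> C then - c e else c e"
  shows "nearest src tgt E c' z b m (sym_diff K0 C)"
proof -
  have flip: "sum c' K = sum c (sym_diff K C)" if "K \<subseteq> E" for K
  proof -
    have "sum c' K = sum c' (K - C) + sum c' (K \<inter> C)"
      using fin_sub[OF that] by (metis add.commute sum.Int_Diff)
    moreover have "sum c' (K - C) = sum c (K - C)"
      by (rule sum.cong) (auto simp: c'_def)
    moreover have "sum c' (K \<inter> C) = - sum c (K \<inter> C)"
      unfolding sum_negf[symmetric] by (rule sum.cong) (auto simp: c'_def)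
    moreover have "sum c K = sum c (K - C) + sum c (K \<inter> C)"
      using fin_sub[OF that] by (metis add.commute sum.Int_Diff)
    ultimately show ?thesis
      using sum_sym_diff[OF fin_sub[OF that] fin_sub[OF C(1)], of c] C(3) by simp
  qed
  have sub: "sym_diff K C \<subseteq> E" if "K \<subseteq> E" for K
    using that C(1) by blast
  show ?thesis
  proof unfold_locales
    show "finite E"
      by (rule fin_E)
    show "0 \<le> sum c' K" if "K \<subseteq> E" "even_set K" for K
      using sum_even_nonneg[OF sub[OF that(1)]] even_set_sym_diff[OF that(2) C(2)] that(1) C(1) fin_sub
      by (simp add: flip)
    show "m \<le> sum c' K" if "K \<subseteq> E" "join z v K" for K v
      using minimal[OF sub[OF that(1)]] join_even_sym_diff[OF that(2) C(2)] that(1) C(1) fin_sub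
      by (simp add: flip)
    show "sym_diff K0 C \<subseteq> E"
      by (rule sub[OF K0(1)])
    show "join z b (sym_diff K0 C)"
      using K0 C join_even_sym_diff fin_sub by blast
    have "sym_diff (sym_diff K0 C) C = K0"
      by auto
    then show "sum c' (sym_diff K0 C) = m"
      using flip[OF sub[OF K0(1)]] K0(3) by simp
    show "m < 0"
      by (rule m_neg)
  qed
qed

lemma unique_negative_crossing_flip:
  assumes C: "C \<subseteq> E" "even_set C" "sum c C = 0"
  defines "c' \<equiv> \<lambda>e. if e \<in> C then - c e else c e"
  assumes "e \<in> E" "c' e < 0" "crosses (cluster b) e"
    and "e' \<in> E" "c' e' < 0" "crosses (cluster b) e'"
  shows "e = e'"
proof -
  interpret F: nearest src tgt E c' z b m "sym_diff K0 C"
    unfolding c'_def by (rule nearest_flip[OF C])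
  \<comment> \<open>Flipping signs keeps the null edges, hence the cluster, so uniqueness applies to
    the same cut.\<close>
  have "c' e = 0 \<longleftrightarrow> c e = 0" for e
    unfolding c'_def by simp
  then have "F.cluster b = cluster b"
    unfolding F.cluster_def cluster_def by simp
  then show ?thesis
    using F.unique_negative_crossing assms(5-) by simp
qed

end

text \<open>There are finitely many joins from \<open>src e\<close>, and \<open>{e}\<close> is one
  of negative weight, so the minimum is attained and negative.\<close>

lemma (in conservative) nearest_exists:
  assumes e: "e \<in> E" "c e < 0"
  obtains b m K0 where "nearest src tgt E c (src e) b m K0"
proof -
  let ?\<K> = "{K. K \<subseteq> E \<and> (\<exists>v. join (src e) v K)}"
  have fin: "finite ?\<K>"
    using fin_E by simp
  have e': "{e} \<in> ?\<K>"
    using e join_edge by blast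
  obtain K0 where K0: "K0 \<in> ?\<K>" "\<forall>K\<in>?\<K>. sum c K0 \<le> sum c K"
    using arg_min_if_finite(1)[of ?\<K> "sum c"] arg_min_least[of ?\<K> _ "sum c"] fin e' by blast
  then obtain b where "join (src e) b K0"
    by blast
  moreover have "sum c K0 < 0"
    using bspec[OF K0(2) e'] e(2) by simp
  ultimately have "nearest src tgt E c (src e) b (sum c K0) K0"
    using K0 by unfold_locales blast+
  then show thesis
    by (rule that)
qed

text \<open>As long as a negative edge is left, some cut crossed by exactly one negative edge can be
  shrunk. Only even sets of weight zero are critical for small \<open>\<epsilon>\<close>; after flipping the signs on
  such a set, at most one negative edge still crosses the cluster.\<close>

lemma (in conservative) shrinkable_cut:
  assumes "e1 \<in> E" "c e1 < 0"
  obtains \<epsilon> e0 S where "\<epsilon> > 0" "e0 \<in> E" "crosses S e0" "c e0 \<le> - \<epsilon>"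
    "\<forall>e\<in>E. crosses S e \<longrightarrow> e \<noteq> e0 \<longrightarrow> \<epsilon> \<le> c e"
    "\<forall>C\<subseteq>E. even_set C \<longrightarrow>
      0 \<le> (\<Sum>e\<in>C. c e - (if crosses S e then if e = e0 then - \<epsilon> else \<epsilon> else 0))"
proof -
  obtain b m K0 where "nearest src tgt E c (src e1) b m K0"
    using nearest_exists[OF assms] .
  then interpret nearest src tgt E c "src e1" b m K0 .
  define S where "S = cluster b"
  obtain e0 where e0: "e0 \<in> E" "c e0 < 0" "crosses S e0"
    using negative_crossing unfolding S_def by metis
  have pos: "0 < c e" if "e \<in> E" "crosses S e" "e \<noteq> e0" for e
    using unique_negative_crossing[of e e0] null_not_crosses_cluster[of e b] that e0
    unfolding S_def by (cases "c e" "0::real" rule: linorder_cases) auto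
  \<comment> \<open>The positive quantities that the perturbation must not exceed: the sizes of the
    crossing weights and the positive weights of even sets. The element 1 is only an additional
    bound.\<close>
  define D where "D = insert 1 (abs ` c ` {e \<in> E. crosses S e} \<union>
      {sum c C | C. C \<subseteq> E \<and> even_set C \<and> sum c C > 0})"
  have "finite {sum c C | C. C \<subseteq> E \<and> even_set C \<and> sum c C > 0}"
    by (rule finite_subset[of _ "sum c ` Pow E"]) (use fin_E in auto)
  then have D: "finite D" "D \<noteq> {}"
    unfolding D_def using fin_E by auto
  have "0 < x" if "x \<in> D" for x
  proof -
    have "c e \<noteq> 0" if "e \<in> E" "crosses S e" for e
      using that null_not_crosses_cluster unfolding S_def by blast
    then show ?thesis
      using that unfolding D_def by auto
  qed
  then have min_pos: "0 < Min D"
    using D by simp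
  \<comment> \<open>Changing at most \<open>card E\<close> edges by \<open>\<epsilon>\<close> each
    stays within every element of \<open>D\<close>.\<close>
  define \<epsilon> where "\<epsilon> = Min D / (1 + card E)"
  have \<epsilon>: "0 < \<epsilon>"
    using min_pos unfolding \<epsilon>_def by simp
  have \<epsilon>E: "\<epsilon> * card E \<le> x" if "x \<in> D" for x
  proof -
    have "\<epsilon> * card E \<le> \<epsilon> * (1 + card E)"
      using \<epsilon> by simp
    also have "\<dots> = Min D"
      unfolding \<epsilon>_def by (simp add: field_simps)
    finally show ?thesis
      using D that by (meson Min_le order_trans)
  qed
  have \<epsilon>1: "\<epsilon> \<le> x" if "x \<in> D" for x
  proof -
    have "card E \<ge> 1"
      using e0(1) fin_E by (metis One_nat_def Suc_leI card_gt_0_iff empty_iff)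
    then have "\<epsilon> \<le> \<epsilon> * card E"
      using \<epsilon> by simp
    then show ?thesis
      using \<epsilon>E[OF that] by simp
  qed
  have abs_ge: "\<epsilon> \<le> \<bar>c e\<bar>" if "e \<in> E" "crosses S e" for e
    by (rule \<epsilon>1) (use that in \<open>auto simp: D_def\<close>)
  let ?\<delta> = "\<lambda>e. if crosses S e then if e = e0 then - \<epsilon> else \<epsilon> else 0"
  have "0 \<le> (\<Sum>e\<in>C. c e - ?\<delta> e)" if C: "C \<subseteq> E" "even_set C" for C
  proof -
    have "sum ?\<delta> C \<le> sum c C"
    proof (cases "sum c C = 0")
      case False
      then have "sum c C \<in> D"
        using C sum_even_nonneg[OF C] unfolding D_def by auto
      have "sum ?\<delta> C \<le> (\<Sum>e\<in>C. \<epsilon>)"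
        by (rule sum_mono) (use \<epsilon> in auto)
      also have "\<dots> \<le> \<epsilon> * card E"
        using \<epsilon> C fin_E by (simp add: card_mono mult.commute)
      also have "\<dots> \<le> sum c C"
        by (rule \<epsilon>E[OF \<open>sum c C \<in> D\<close>])
      finally show ?thesis .
    next
      case True
      note uniq = unique_negative_crossing_flip[OF C True, folded S_def]
      let ?P = "{e \<in> C. crosses S e \<and> e \<noteq> e0}"
      show ?thesis
      proof (cases "?P = {}")
        case True
        then have "sum ?\<delta> C \<le> 0"
          using \<epsilon> by (intro sum_nonpos) auto
        then show ?thesis
          using \<open>sum c C = 0\<close> by simp
      next
        case False
        then obtain e where e: "e \<in> C" "crosses S e" "e \<noteq> e0"
          by blast
        \<comment> \<open>The positive edge \<open>e\<close> turns negative under the flip. If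
          \<open>e0\<close> were outside \<open>C\<close> it would remain negative, against
          uniqueness. In the same way \<open>e\<close> is the only other crossing edge of
          \<open>C\<close>, so the changes at \<open>e\<close> and \<open>e0\<close> cancel.\<close>
        have "e0 \<in> C"
          using uniq[of e e0] e e0 C(1) pos[of e] by (cases "e0 \<in> C") auto
        have "f = e" if "f \<in> C" "crosses S f" "f \<noteq> e0" for f
          using uniq[of e f] e that C(1) pos[of e] pos[of f] by auto
        then have "sum ?\<delta> (C - {e, e0}) = 0"
          by (intro sum.neutral) auto
        moreover have "sum ?\<delta> C = sum ?\<delta> (C - {e, e0}) + sum ?\<delta> {e, e0}"
          using e \<open>e0 \<in> C\<close> fin_sub[OF C(1)] by (intro sum.subset_diff) auto
        ultimately have "sum ?\<delta> C = 0"
          using e e0 by simp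
        then show ?thesis
          using \<open>sum c C = 0\<close> by simp
      qed
    qed
    then show ?thesis
      by (simp add: sum_subtractf)
  qed
  moreover have "c e0 \<le> - \<epsilon>"
    using abs_ge[OF e0(1,3)] e0(2) by simp
  moreover have "\<epsilon> \<le> c e" if "e \<in> E" "crosses S e" "e \<noteq> e0" for e
    using abs_ge[OF that(1,2)] pos[OF that] by simp
  ultimately show thesis
    using that[OF \<epsilon> e0(1,3)] by blast
qed

section \<open>Compactness\<close>

text \<open>Tychonoff's theorem for a full function type, whose topology is that of pointwise
  convergence.\<close>

lemma compact_Pi_UNIV:
  fixes S :: "'i \<Rightarrow> 'b::topological_space set"
  assumes "\<And>i. compact (S i)"
  shows "compact {f. \<forall>i. f i \<in> S i}"
proof -
  have "compactin (product_topology (\<lambda>i. euclidean) UNIV) (PiE UNIV S)"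
    unfolding compactin_PiE using assms by auto
  moreover have "PiE UNIV S = {f. \<forall>i. f i \<in> S i}"
    by (auto simp: PiE_UNIV_domain)
  ultimately show ?thesis
    by (simp add: euclidean_product_topology)
qed

lemma compact_bounded_functions:
  fixes r :: "'a \<Rightarrow> real"
  shows "compact {f. \<forall>x. \<bar>f x\<bar> \<le> r x}"
proof -
  have "{f. \<forall>x. \<bar>f x\<bar> \<le> r x} = {f. \<forall>x. f x \<in> {- r x..r x}}"
    by (auto simp: abs_le_iff minus_le_iff)
  then show ?thesis
    using compact_Pi_UNIV[of "\<lambda>x. {- r x..r x}"] by simp
qed

lemma compact_bounded_families:
  fixes r :: "'a \<Rightarrow> real"
  shows "compact {\<phi> :: 'i \<Rightarrow> 'a \<Rightarrow> real. \<forall>i x. \<bar>\<phi> i x\<bar> \<le> r x}"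
  using compact_Pi_UNIV[of "\<lambda>i. {f. \<forall>x. \<bar>f x\<bar> \<le> r x}"] compact_bounded_functions[of r] by simp

lemma continuous_on_eval [continuous_intros]:
  "continuous_on A (\<lambda>f. f x :: 'b::topological_space)"
  by (rule continuous_on_subset[OF continuous_on_product_coordinates subset_UNIV])

lemma continuous_on_eval2 [continuous_intros]:
  "continuous_on A (\<lambda>\<phi>. \<phi> i x :: 'b::topological_space)"
  by (rule continuous_on_product_then_coordinatewise[of A "\<lambda>\<phi>. \<phi> i" x, OF continuous_on_eval])

lemma closed_Collect_ball:
  assumes "\<And>a. a \<in> A \<Longrightarrow> closed {x. P a x}"
  shows "closed {x. \<forall>a\<in>A. P a x}"
proof -
  have "{x. \<forall>a\<in>A. P a x} = (\<Inter>a\<in>A. {x. P a x})"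
    by auto
  then show ?thesis
    using assms by auto
qed

section \<open>Uniform interpolation\<close>

text \<open>Membership in \<open>Lip0 z\<close> bounds the quotients, so \<open>Sup\<close> is a
  true supremum; \<open>0 \<le> K\<close> takes care of the inserted 0.\<close>

lemma lip_norm_le_iff:
  assumes "f \<in> Lip0 z" "0 \<le> K"
  shows "lip_norm f \<le> K \<longleftrightarrow> (\<forall>x y. \<bar>f x - f y\<bar> \<le> K * dist x y)"
proof -
  let ?A = "insert 0 {\<bar>f x - f y\<bar> / dist x y | x y. x \<noteq> y}"
  obtain L where L: "\<And>x y. \<bar>f x - f y\<bar> \<le> L * dist x y"
    using assms(1) unfolding Lip0_def by blast
  have "a \<le> max 0 L" if "a \<in> ?A" for a
    using that L by (auto simp: divide_le_eq le_max_iff_disj)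
  then have "bdd_above ?A"
    by (rule bdd_aboveI)
  then have "lip_norm f \<le> K \<longleftrightarrow> (\<forall>a\<in>?A. a \<le> K)"
    unfolding lip_norm_def by (intro cSup_le_iff) auto
  also have "\<dots> \<longleftrightarrow> (\<forall>x y. x \<noteq> y \<longrightarrow> \<bar>f x - f y\<bar> / dist x y \<le> K)"
    using assms(2) by auto
  also have "\<dots> \<longleftrightarrow> (\<forall>x y. \<bar>f x - f y\<bar> \<le> K * dist x y)"
    by (auto simp: divide_le_eq) (metis diff_self abs_zero dist_self mult_zero_right order_refl)
  finally show ?thesis .
qed

definition interpolates_with ::
  "'a::metric_space \<Rightarrow> 'i set \<Rightarrow> ('i \<Rightarrow> 'a) \<Rightarrow> ('i \<Rightarrow> 'a) \<Rightarrow> real \<Rightarrow> bool" where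
  "interpolates_with z I xs ys K \<longleftrightarrow> (\<forall>\<alpha>. (\<forall>i\<in>I. \<bar>\<alpha> i\<bar> \<le> 1) \<longrightarrow>
     (\<exists>f. f z = 0 \<and> (\<forall>x y. \<bar>f x - f y\<bar> \<le> K * dist x y) \<and> (\<forall>i\<in>I. lip_T xs ys f i = \<alpha> i)))"

lemma interpolates_with_iff:
  assumes "0 \<le> K"
  shows "interpolates_with z I xs ys K \<longleftrightarrow> (\<forall>\<alpha>. (\<forall>i\<in>I. \<bar>\<alpha> i\<bar> \<le> 1) \<longrightarrow>
        (\<exists>f\<in>Lip0 z. lip_norm f \<le> K \<and> (\<forall>i\<in>I. lip_T xs ys f i = \<alpha> i)))"
proof -
  have "f z = 0 \<and> (\<forall>x y. \<bar>f x - f y\<bar> \<le> K * dist x y) \<longleftrightarrow> f \<in> Lip0 z \<and> lip_norm f \<le> K" for f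
  proof (cases "f \<in> Lip0 z")
    case True
    then show ?thesis
      using lip_norm_le_iff[OF True assms] unfolding Lip0_def by auto
  next
    case False
    then show ?thesis
      unfolding Lip0_def by blast
  qed
  then have "(\<exists>f. f z = 0 \<and> (\<forall>x y. \<bar>f x - f y\<bar> \<le> K * dist x y) \<and> R f) \<longleftrightarrow>
      (\<exists>f\<in>Lip0 z. lip_norm f \<le> K \<and> R f)" for R
    by blast
  then show ?thesis
    unfolding interpolates_with_def by (simp only:)
qed

text \<open>The Baire category theorem on the compact space \<open>[-1,1]\<^sup>I\<close>. Without it the set defining the
  interpolation constant might be empty, and its infimum a junk value.\<close>

lemma lip_interpolating_uniform:
  assumes "lip_interpolating z I xs ys"
  obtains K where "1 \<le> K" "interpolates_with z I xs ys K"
proof -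
  define X where "X = product_topology (\<lambda>_::'b. top_of_set {-1..1::real}) I"
  define T where "T f = restrict (lip_T xs ys f) I" for f
  \<comment> \<open>The first condition makes \<open>L n\<close> part of a compact box, and at
    \<open>x = z\<close> it forces \<open>f z = 0\<close>.\<close>
  define L where "L n = {f. \<forall>x. \<bar>f x\<bar> \<le> real n * dist x z} \<inter>
      {f. (\<forall>x y. \<bar>f x - f y\<bar> \<le> real n * dist x y) \<and> (\<forall>i\<in>I. \<bar>lip_T xs ys f i\<bar> \<le> 1)}" for n
  have cont: "continuous_on A (\<lambda>f. lip_T xs ys f i)" for A i
    unfolding lip_T_def divide_inverse by (intro continuous_intros)
  have Q: "topspace X = PiE I (\<lambda>_. {-1..1})"
    unfolding X_def by simp
  have "compact (L n)" for n
    unfolding L_def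
    by (intro compact_Int_closed compact_bounded_functions closed_Collect_conj closed_Collect_all
        closed_Collect_ball closed_Collect_le continuous_intros cont)
  then have "compactin X (T ` L n)" for n
  proof -
    have "continuous_map (top_of_set (L n)) X T"
      unfolding X_def continuous_map_componentwise
      using cont by (auto simp: T_def L_def continuous_map_in_subtopology abs_le_iff minus_le_iff)
    moreover have "compactin (top_of_set (L n)) (L n)"
      using \<open>compact (L n)\<close> by (simp add: compactin_subtopology)
    ultimately show ?thesis
      by (rule image_compactin[rotated])
  qed
  moreover have haus: "Hausdorff_space X"
    unfolding X_def by (simp add: Hausdorff_space_product_topology Hausdorff_space_subtopology)
  ultimately have clo: "closedin X (T ` L n)" for n
    by (simp add: compactin_imp_closedin)
  have comp: "compact_space X"
    unfolding X_def by (simp add: compact_space_product_topology compact_space_subtopology)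
  \<comment> \<open>Each interpolating function has some integer Lipschitz bound, so countably many
    closed sets cover the cube and one of them has interior.\<close>
  have "topspace X \<subseteq> (\<Union>n. T ` L n)"
  proof
    fix \<alpha> assume "\<alpha> \<in> topspace X"
    then have \<alpha>: "\<And>i. i \<in> I \<Longrightarrow> \<bar>\<alpha> i\<bar> \<le> 1" "restrict \<alpha> I = \<alpha>"
      unfolding Q by (auto simp: PiE_iff abs_le_iff minus_le_iff extensional_restrict)
    then have "\<alpha> \<in> linf I"
      unfolding linf_def by blast
    then obtain f where f: "f \<in> Lip0 z" "\<forall>i\<in>I. lip_T xs ys f i = \<alpha> i"
      using assms unfolding lip_interpolating_def by blast
    then obtain B where B: "\<And>x y. \<bar>f x - f y\<bar> \<le> B * dist x y" and "f z = 0"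
      unfolding Lip0_def by blast
    obtain n where "B \<le> real n"
      using real_arch_simple by blast
    then have n: "\<bar>f x - f y\<bar> \<le> real n * dist x y" for x y
      using B[of x y] by (meson mult_right_mono order_trans zero_le_dist)
    have "\<bar>f x\<bar> \<le> real n * dist x z" for x
      using n[of x z] \<open>f z = 0\<close> by simp
    then have "f \<in> L n"
      unfolding L_def using n f(2) \<alpha>(1) by simp
    moreover have "T f = \<alpha>"
      unfolding T_def using f(2) \<alpha>(2) by (metis restrict_ext)
    ultimately show "\<alpha> \<in> (\<Union>n. T ` L n)"
      by blast
  qed
  moreover have "topspace X \<noteq> {}"
    unfolding Q by (auto simp: PiE_eq_empty_iff)
  ultimately have "X interior_of (\<Union>(range (\<lambda>n. T ` L n))) \<noteq> {}"
    by (metis interior_of_mono interior_of_topspace subset_empty)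
  moreover have "locally_compact_space X \<and> regular_space X"
    using comp haus compact_imp_locally_compact_space compact_Hausdorff_imp_regular_space by blast
  ultimately have "\<not> (\<forall>n. X interior_of (T ` L n) = {})"
    using Baire_category_alt[of X "range (\<lambda>n. T ` L n)"] clo by auto
  then obtain n \<beta> where \<beta>: "\<beta> \<in> X interior_of (T ` L n)"
    by blast
  have "\<exists>U. finite {i \<in> I. U i \<noteq> topspace (top_of_set {-1..1::real})} \<and>
      (\<forall>i\<in>I. openin (top_of_set {-1..1}) (U i)) \<and> \<beta> \<in> PiE I U \<and>
      PiE I U \<subseteq> X interior_of (T ` L n)"
    using openin_interior_of[of X "T ` L n"] \<beta>
    unfolding X_def openin_product_topology_alt by (rule bspec)
  then obtain U where U: "finite {i \<in> I. U i \<noteq> {-1..1}}"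
    "\<And>i. i \<in> I \<Longrightarrow> openin (top_of_set {-1..1}) (U i)"
    "\<beta> \<in> PiE I U" "PiE I U \<subseteq> X interior_of (T ` L n)"
    unfolding topspace_euclidean_subtopology by blast
  have sub: "PiE I U \<subseteq> T ` L n"
    by (rule subset_trans[OF U(4) interior_of_subset])
  have "\<exists>\<eta>>0. \<forall>t\<in>{-1..1}. \<bar>t - \<beta> i\<bar> < \<eta> \<longrightarrow> t \<in> U i" if "i \<in> I" for i
    using U(2)[OF that] U(3) that unfolding openin_euclidean_subtopology_iff
    by (auto simp: PiE_iff dist_real_def)
  then obtain \<eta> where \<eta>: "\<And>i. i \<in> I \<Longrightarrow> 0 < \<eta> i"
    "\<And>i t. i \<in> I \<Longrightarrow> t \<in> {-1..1} \<Longrightarrow> \<bar>t - \<beta> i\<bar> < \<eta> i \<Longrightarrow> t \<in> U i"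
    by metis
  \<comment> \<open>Only finitely many coordinates are restricted by \<open>U\<close>. Moving from
    \<open>\<beta>\<close> a fraction \<open>\<delta>\<close> of the way to any point of the cube
    changes a coordinate by at most \<open>2 * \<delta>\<close>, which keeps it in
    \<open>U i\<close>.\<close>
  define \<delta> where "\<delta> = Min (insert 1 (\<eta> ` {i \<in> I. U i \<noteq> {-1..1}})) / 4"
  have "Min (insert 1 (\<eta> ` {i \<in> I. U i \<noteq> {-1..1}})) \<le> 1"
    using U(1) by (intro Min_le) auto
  then have \<delta>1: "\<delta> \<le> 1"
    unfolding \<delta>_def by linarith
  have \<delta>: "0 < \<delta>"
    using U(1) \<eta>(1) by (auto simp: \<delta>_def)
  have \<delta>_less: "2 * \<delta> < \<eta> i" if "i \<in> I" "U i \<noteq> {-1..1}" for i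
  proof -
    have "4 * \<delta> \<le> \<eta> i"
      using U(1) that unfolding \<delta>_def by (auto intro: Min_le)
    then show ?thesis
      using \<delta> by simp
  qed
  obtain g where g: "g \<in> L n" "T g = \<beta>"
    using sub U(3) by blast
  have \<beta>1: "\<beta> i \<in> {-1..1}" if "i \<in> I" for i
    using U(2)[OF that] U(3) that openin_imp_subset by (metis PiE_mem subsetD)
  define K where "K = max 1 ((real n + real n) / \<delta>)"
  have "interpolates_with z I xs ys K"
    unfolding interpolates_with_def
  proof (intro allI impI)
    fix \<alpha> :: "'b \<Rightarrow> real"
    assume \<alpha>: "\<forall>i\<in>I. \<bar>\<alpha> i\<bar> \<le> 1"
    define \<gamma> where "\<gamma> = restrict (\<lambda>i. (1 - \<delta>) * \<beta> i + \<delta> * \<alpha> i) I"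
    have "\<gamma> i \<in> U i" if "i \<in> I" for i
    proof -
      have "\<gamma> i \<in> {-1..1}"
        unfolding \<gamma>_def using that \<beta>1[OF that] \<alpha> \<delta> \<delta>1 convexD[of "{-1..1::real}" "\<beta> i" "\<alpha> i" "1 - \<delta>" \<delta>]
        by (auto simp: abs_le_iff minus_le_iff)
      moreover have "\<bar>\<gamma> i - \<beta> i\<bar> \<le> 2 * \<delta>"
      proof -
        have "\<bar>\<alpha> i - \<beta> i\<bar> \<le> 2"
          using \<alpha> that \<beta>1[OF that] by (force simp: abs_le_iff)
        moreover have "\<gamma> i - \<beta> i = \<delta> * (\<alpha> i - \<beta> i)"
          unfolding \<gamma>_def using that by (simp add: algebra_simps)
        ultimately show ?thesis
          using \<delta> by (simp add: abs_mult)
      qed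
      ultimately show ?thesis
        using \<eta>(2)[OF that] \<delta>_less[OF that] by (cases "U i = {-1..1}") auto
    qed
    then have "\<gamma> \<in> PiE I U"
      unfolding \<gamma>_def by (auto simp: PiE_iff)
    then obtain h where h: "h \<in> L n" "T h = \<gamma>"
      using sub by blast
    \<comment> \<open>Solves \<open>h = (1 - \<delta>) * g + \<delta> * f\<close>; as
      \<open>g\<close> and \<open>h\<close> have Lipschitz bound \<open>n\<close>, this explains the
      choice of \<open>K\<close>.\<close>
    define f where "f x = (h x - (1 - \<delta>) * g x) / \<delta>" for x
    have "f z = 0"
      using g(1) h(1) unfolding f_def L_def by auto (metis abs_le_zero_iff diff_zero dist_self mult_zero_right)
    moreover have "\<bar>f x - f y\<bar> \<le> K * dist x y" for x y
    proof -
      have "\<bar>f x - f y\<bar> = \<bar>(h x - h y) - (1 - \<delta>) * (g x - g y)\<bar> / \<delta>"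
        unfolding f_def using \<delta> by (simp add: diff_divide_distrib[symmetric] algebra_simps)
      also have "\<dots> \<le> (\<bar>h x - h y\<bar> + \<bar>(1 - \<delta>) * (g x - g y)\<bar>) / \<delta>"
        using \<delta> by (intro divide_right_mono) auto
      also have "\<dots> \<le> (real n * dist x y + real n * dist x y) / \<delta>"
      proof -
        have "\<bar>(1 - \<delta>) * (g x - g y)\<bar> \<le> 1 * (real n * dist x y)"
          using \<delta> \<delta>1 g(1) unfolding abs_mult L_def by (intro mult_mono) auto
        moreover have "\<bar>h x - h y\<bar> \<le> real n * dist x y"
          using h(1) unfolding L_def by auto
        ultimately show ?thesis
          using \<delta> by (intro divide_right_mono) auto
      qed
      also have "\<dots> = ((real n + real n) / \<delta>) * dist x y"
        by (simp add: field_simps)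
      also have "\<dots> \<le> K * dist x y"
        unfolding K_def by (intro mult_right_mono) auto
      finally show ?thesis .
    qed
    moreover have "lip_T xs ys f i = \<alpha> i" if "i \<in> I" for i
    proof -
      have "lip_T xs ys h i = (1 - \<delta>) * \<beta> i + \<delta> * \<alpha> i" "lip_T xs ys g i = \<beta> i"
        using fun_cong[OF h(2), of i] fun_cong[OF g(2), of i] that
        by (simp_all add: T_def \<gamma>_def)
      moreover have "lip_T xs ys f i = (lip_T xs ys h i - (1 - \<delta>) * lip_T xs ys g i) / \<delta>"
        unfolding lip_T_def f_def by (simp add: diff_divide_distrib right_diff_distrib mult.commute)
      ultimately show ?thesis
        using \<delta> by simp
    qed
    ultimately show "\<exists>f. f z = 0 \<and> (\<forall>x y. \<bar>f x - f y\<bar> \<le> K * dist x y) \<and>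
        (\<forall>i\<in>I. lip_T xs ys f i = \<alpha> i)"
      by blast
  qed
  moreover have "1 \<le> K"
    unfolding K_def by simp
  ultimately show thesis
    using that by blast
qed

text \<open>The infimum is not known to be attained at this point, so only constants arbitrarily
  close to 1 are obtained.\<close>

lemma interp_const_1_interpolates_with:
  assumes "lip_interpolating z I xs ys" "lip_interp_const z I xs ys = 1" "1 < K"
  obtains K' where "1 \<le> K'" "K' < K" "interpolates_with z I xs ys K'"
proof -
  have "lip_interp_const z I xs ys = Inf {K. 1 \<le> K \<and> interpolates_with z I xs ys K}"
    unfolding lip_interp_const_def
    by (rule arg_cong[where f = Inf]) (auto simp: interpolates_with_iff)
  moreover have "{K. 1 \<le> K \<and> interpolates_with z I xs ys K} \<noteq> {}"
    using lip_interpolating_uniform[OF assms(1)] by blast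
  ultimately show thesis
    using that cInf_lessD[of "{K. 1 \<le> K \<and> interpolates_with z I xs ys K}" K] assms(2,3) by auto
qed

section \<open>Packings\<close>

text \<open>The pairs \<open>(x\<^sub>i, y\<^sub>i)\<close> are edges \<open>Inl i\<close> of negative weight, pairs of points are edges
  \<open>Inr (u, v)\<close> of nonnegative weight. A family of functions is packed into the edges, and
  \<open>residual\<close> is the weight that is left.\<close>

definition pair_src :: "('i \<Rightarrow> 'a) \<Rightarrow> 'i + 'a \<times> 'a \<Rightarrow> 'a" where
  "pair_src xs = case_sum xs fst"

definition pair_tgt :: "('i \<Rightarrow> 'a) \<Rightarrow> 'i + 'a \<times> 'a \<Rightarrow> 'a" where
  "pair_tgt ys = case_sum ys snd"

definition pair_edges :: "'i set \<Rightarrow> 'a set \<Rightarrow> ('i + 'a \<times> 'a) set" where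
  "pair_edges I V = Inl ` I \<union> Inr ` (V \<times> V)"

definition residual ::
  "'i set \<Rightarrow> ('i \<Rightarrow> 'a::metric_space) \<Rightarrow> ('i \<Rightarrow> 'a) \<Rightarrow> ('i \<Rightarrow> 'a \<Rightarrow> real) \<Rightarrow> 'i + 'a \<times> 'a \<Rightarrow> real" where
  "residual I xs ys \<phi> = case_sum
     (\<lambda>i. \<phi> i (xs i) - \<phi> i (ys i) - dist (xs i) (ys i))
     (\<lambda>p. dist (fst p) (snd p) - (\<Sum>i\<in>I. \<bar>\<phi> i (fst p) - \<phi> i (snd p)\<bar>))"

lemma residual_simps [simp]:
  "residual I xs ys \<phi> (Inl i) = \<phi> i (xs i) - \<phi> i (ys i) - dist (xs i) (ys i)"
  "residual I xs ys \<phi> (Inr (u, v)) = dist u v - (\<Sum>i\<in>I. \<bar>\<phi> i u - \<phi> i v\<bar>)"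
  unfolding residual_def by simp_all

lemma continuous_on_residual [continuous_intros]:
  "continuous_on A (\<lambda>\<phi>. residual I xs ys \<phi> e)"
proof (cases e)
  case (Inr p)
  then show ?thesis
    by (cases p) (auto intro!: continuous_intros)
qed (auto intro!: continuous_intros)

text \<open>Let \<open>f\<close> interpolate the signs of an Eulerian orientation of
  \<open>C\<close>. In the vanishing signed sum each edge of \<open>M\<close> contributes its full
  length, and each edge of \<open>N\<close> at least \<open>- K\<close> times its length. So
  \<open>M\<close> is at most \<open>K\<close> times as long as \<open>N\<close>, and
  \<open>K\<close> can approach 1.\<close>

lemma interpolates_with_conservative:
  assumes xy: "\<And>i. i \<in> I \<Longrightarrow> xs i \<noteq> ys i"
    and interp: "\<And>K. 1 < K \<Longrightarrow> \<exists>K'. 1 \<le> K' \<and> K' < K \<and> interpolates_with z I xs ys K'"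
    and C: "finite C" "C \<subseteq> pair_edges I V" "multigraph.even_set (pair_src xs) (pair_tgt ys) C"
  shows "0 \<le> sum (residual J xs ys (\<lambda>_ _. 0)) C"
proof -
  define M N where "M = C \<inter> range Inl" and "N = C - range Inl"
  define len where "len e = dist (pair_src xs e) (pair_tgt ys e)" for e
  have fin: "finite M" "finite N"
    unfolding M_def N_def using C(1) by auto
  have split: "sum g C = sum g M + sum g N" for g :: "_ \<Rightarrow> real"
    unfolding M_def N_def using C(1) by (rule sum.Int_Diff)
  obtain \<sigma> where \<sigma>: "\<And>e. \<bar>\<sigma> e\<bar> = (1::real)"
    "\<And>h. (\<Sum>e\<in>C. \<sigma> e * (h (pair_src xs e) - h (pair_tgt ys e))) = 0"
    using even_set_orientation[OF C(1,3)] by blast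
  have bound: "sum len M \<le> K * sum len N" if "interpolates_with z I xs ys K" for K
  proof -
    have "\<forall>i\<in>I. \<bar>\<sigma> (Inl i)\<bar> \<le> 1"
      using \<sigma>(1) by simp
    then obtain f where f: "\<And>x y. \<bar>f x - f y\<bar> \<le> K * dist x y"
      "\<And>i. i \<in> I \<Longrightarrow> lip_T xs ys f i = \<sigma> (Inl i)"
      using \<open>interpolates_with z I xs ys K\<close>[unfolded interpolates_with_def, rule_format, of "\<lambda>i. \<sigma> (Inl i)"]
      by blast
    let ?g = "\<lambda>e. \<sigma> e * (f (pair_src xs e) - f (pair_tgt ys e))"
    have "sum ?g M = sum len M"
    proof (rule sum.cong)
      fix e assume "e \<in> M"
      then obtain i where i: "e = Inl i" "i \<in> I"
        using C(2) unfolding M_def pair_edges_def by auto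
      have "f (xs i) - f (ys i) = \<sigma> e * dist (xs i) (ys i)"
        using f(2)[OF i(2)] xy[OF i(2)] i(1) unfolding lip_T_def by (simp add: field_simps)
      moreover have "\<sigma> e * \<sigma> e = 1"
        using \<sigma>(1)[of e] by (metis abs_mult_self_eq mult_1)
      ultimately show "?g e = len e"
        unfolding len_def using i(1) by (simp add: pair_src_def pair_tgt_def mult.assoc[symmetric])
    qed simp
    moreover have "- (K * sum len N) \<le> sum ?g N"
      unfolding sum_distrib_left sum_negf[symmetric]
    proof (rule sum_mono)
      fix e
      have "\<bar>?g e\<bar> \<le> K * len e"
        using f(1) \<sigma>(1) unfolding len_def abs_mult by simp
      then show "- (K * len e) \<le> ?g e"
        by linarith
    qed
    ultimately show ?thesis
      using split[of ?g] \<sigma>(2)[of f] by linarith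
  qed
  have N0: "0 \<le> sum len N"
    unfolding len_def by (simp add: sum_nonneg)
  have "sum len M \<le> sum len N"
  proof (rule ccontr)
    assume "\<not> sum len M \<le> sum len N"
    then have gap: "0 < sum len M - sum len N"
      by simp
    \<comment> \<open>Chosen so that \<open>(?K - 1) * sum len N\<close> is smaller than the gap;
      the 1 in the denominator covers \<open>sum len N = 0\<close>.\<close>
    let ?K = "1 + (sum len M - sum len N) / (1 + sum len N)"
    have "1 < ?K"
      using gap N0 by simp
    then obtain K where K: "1 \<le> K" "K < ?K" "interpolates_with z I xs ys K"
      using interp by blast
    have "sum len M \<le> ?K * sum len N"
      using bound[OF K(3)] K(2) N0 by (meson less_imp_le mult_right_mono order_trans)
    moreover have "(sum len M - sum len N) / (1 + sum len N) * sum len N < sum len M - sum len N"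
      using gap N0 by (simp add: divide_less_eq mult.commute distrib_left)
    ultimately show False
      by (simp add: distrib_right)
  qed
  moreover have "sum (residual J xs ys (\<lambda>_ _. 0)) M = - sum len M"
    unfolding sum_negf[symmetric]
    by (rule sum.cong) (auto simp: M_def len_def pair_src_def pair_tgt_def)
  moreover have "sum (residual J xs ys (\<lambda>_ _. 0)) N = sum len N"
  proof (rule sum.cong)
    fix e assume "e \<in> N"
    then obtain u v where "e = Inr (u, v)"
      unfolding N_def by (cases e) auto
    then show "residual J xs ys (\<lambda>_ _. 0) e = len e"
      by (simp add: len_def pair_src_def pair_tgt_def)
  qed simp
  ultimately show ?thesis
    using split[of "residual J xs ys (\<lambda>_ _. 0)"] by linarith
qed

text \<open>A feasible packing of maximal \<open>gain\<close> exists by compactness. If a demand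
  edge were not exhausted, a shrinkable cut could be added to the packing and would raise
  \<open>gain\<close>.\<close>

lemma finite_packing:
  fixes xs ys :: "'i \<Rightarrow> 'a::metric_space"
  assumes fin: "finite I" "finite V"
    and V: "z \<in> V" "xs ` I \<subseteq> V" "ys ` I \<subseteq> V"
    and cons: "\<And>C. C \<subseteq> pair_edges I V \<Longrightarrow> multigraph.even_set (pair_src xs) (pair_tgt ys) C \<Longrightarrow>
      0 \<le> sum (residual I xs ys (\<lambda>_ _. 0)) C"
  shows "\<exists>\<phi>. (\<forall>i x. \<bar>\<phi> i x\<bar> \<le> dist x z) \<and>
    (\<forall>i\<in>I. \<forall>j\<in>I. \<phi> i (xs j) - \<phi> i (ys j) = (if i = j then dist (xs j) (ys j) else 0)) \<and>
    (\<forall>u\<in>V. \<forall>v\<in>V. (\<Sum>i\<in>I. \<bar>\<phi> i u - \<phi> i v\<bar>) \<le> dist u v)"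
proof -
  define E where "E = pair_edges I V"
  define r where "r = residual I xs ys"
  interpret multigraph "pair_src xs" "pair_tgt ys" .
  define box where "box = {\<phi> :: 'i \<Rightarrow> 'a \<Rightarrow> real. \<forall>i x. \<bar>\<phi> i x\<bar> \<le> dist x z}"
  \<comment> \<open>Conservativity of the residual weights is itself a constraint, so that
    \<open>shrinkable_cut\<close> applies at the maximum.\<close>
  define feas where "feas = {\<phi> :: 'i \<Rightarrow> 'a \<Rightarrow> real.
      (\<forall>i\<in>I. \<forall>j\<in>I - {i}. \<phi> i (xs j) = \<phi> i (ys j)) \<and>
      (\<forall>i\<in>I. r \<phi> (Inl i) \<le> 0) \<and> (\<forall>p\<in>V \<times> V. 0 \<le> r \<phi> (Inr p)) \<and>
      (\<forall>C\<in>{C. C \<subseteq> E \<and> even_set C}. 0 \<le> sum (r \<phi>) C)}"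
  define gain where "gain \<phi> = (\<Sum>i\<in>I. \<phi> i (xs i) - \<phi> i (ys i))" for \<phi> :: "'i \<Rightarrow> 'a \<Rightarrow> real"
  have finE: "finite E"
    unfolding E_def pair_edges_def using fin by simp
  have "compact (box \<inter> feas)"
    unfolding box_def feas_def r_def
    by (intro compact_Int_closed compact_bounded_families closed_Collect_conj closed_Collect_ball
        closed_Collect_eq closed_Collect_le continuous_intros)
  moreover have "(\<lambda>_ _. 0) \<in> box \<inter> feas"
    using cons unfolding box_def feas_def r_def E_def by (auto simp del: split_paired_All)
  moreover have "continuous_on (box \<inter> feas) gain"
    unfolding gain_def by (intro continuous_intros)
  ultimately obtain \<phi> where \<phi>: "\<phi> \<in> box \<inter> feas" "\<And>\<psi>. \<psi> \<in> box \<inter> feas \<Longrightarrow> gain \<psi> \<le> gain \<phi>"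
    using continuous_attains_sup[of "box \<inter> feas" gain] by auto
  have feas1: "\<phi> i (xs j) = \<phi> i (ys j)" if "i \<in> I" "j \<in> I" "i \<noteq> j" for i j
    using \<phi>(1) that unfolding feas_def by auto
  have feas2: "r \<phi> (Inl i) \<le> 0" if "i \<in> I" for i
    using \<phi>(1) that unfolding feas_def by auto
  have feas3: "0 \<le> r \<phi> (Inr (u, v))" if "u \<in> V" "v \<in> V" for u v
    using \<phi>(1) that unfolding feas_def by auto
  have feas4: "0 \<le> sum (r \<phi>) C" if "C \<subseteq> E" "even_set C" for C
    using \<phi>(1) that unfolding feas_def by auto
  interpret conservative "pair_src xs" "pair_tgt ys" E "r \<phi>"
    using finE feas4 by unfold_locales
  have tight: "r \<phi> (Inl i) = 0" if i: "i \<in> I" for i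
  proof (rule ccontr)
    assume "r \<phi> (Inl i) \<noteq> 0"
    then have "Inl i \<in> E" "r \<phi> (Inl i) < 0"
      using feas2[OF i] i unfolding E_def pair_edges_def by auto
    then obtain \<epsilon> e0 S where S: "\<epsilon> > 0" "e0 \<in> E" "crosses S e0" "r \<phi> e0 \<le> - \<epsilon>"
      "\<forall>e\<in>E. crosses S e \<longrightarrow> e \<noteq> e0 \<longrightarrow> \<epsilon> \<le> r \<phi> e"
      and red: "\<forall>C\<subseteq>E. even_set C \<longrightarrow>
        0 \<le> (\<Sum>e\<in>C. r \<phi> e - (if crosses S e then if e = e0 then - \<epsilon> else \<epsilon> else 0))"
      by (rule shrinkable_cut)
    \<comment> \<open>The negative edge of the cut is some \<open>Inl k\<close>, because point pairs
      have nonnegative residual.\<close>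
    obtain k where k: "e0 = Inl k" "k \<in> I"
    proof (cases e0)
      case (Inl k)
      then show thesis
        using that S(2) unfolding E_def pair_edges_def by auto
    next
      case (Inr p)
      then obtain u v where "e0 = Inr (u, v)" "u \<in> V" "v \<in> V"
        using S(2) unfolding E_def pair_edges_def by auto
      then show thesis
        using feas3[of u v] S(1,4) by simp
    qed
    have kS: "(xs k \<in> S) \<noteq> (ys k \<in> S)"
      using S(3) unfolding crosses_def k(1) by (simp add: pair_src_def pair_tgt_def)
    \<comment> \<open>Any other demand edge crossing \<open>S\<close> would have residual at least
      \<open>\<epsilon>\<close>, but these residuals are at most 0.\<close>
    have jS: "(xs j \<in> S) = (ys j \<in> S)" if "j \<in> I" "j \<noteq> k" for j
      using S(1) bspec[OF S(5), of "Inl j"] feas2[OF that(1)] that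
      unfolding crosses_def k(1) E_def pair_edges_def by (force simp: pair_src_def pair_tgt_def)
    \<comment> \<open>A multiple of the indicator of \<open>S\<close>, shifted to vanish at
      \<open>z\<close>, with the sign that makes
      \<open>s (xs k) - s (ys k) = \<epsilon>\<close>.\<close>
    define s where "s u = (if xs k \<in> S then \<epsilon> else - \<epsilon>) *
      (of_bool (u \<in> S) - of_bool (z \<in> S))" for u
    define \<psi> where "\<psi> = (\<lambda>i u. \<phi> i u + (if i = k \<and> u \<in> V then s u else 0))"
    have sV: "\<bar>s u - s v\<bar> = (if (u \<in> S) \<noteq> (v \<in> S) then \<epsilon> else 0)" for u v
      using S(1) unfolding s_def by auto
    have inV: "xs j \<in> V" "ys j \<in> V" if "j \<in> I" for j
      using V that by auto
    have rk: "r \<psi> (Inl k) = r \<phi> (Inl k) + \<epsilon>"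
      using kS S(1) inV[OF k(2)] unfolding r_def \<psi>_def s_def by (auto simp: algebra_simps)
    have rj: "r \<psi> (Inl j) = r \<phi> (Inl j)" if "j \<noteq> k" for j
      using that unfolding r_def \<psi>_def by simp
    \<comment> \<open>Old and new parts of \<open>\<phi> k\<close> may partly cancel, so this is
      only an inequality; a lower bound on the residual suffices for feasibility.\<close>
    have ruv: "r \<phi> (Inr (u, v)) - (if (u \<in> S) \<noteq> (v \<in> S) then \<epsilon> else 0) \<le> r \<psi> (Inr (u, v))"
      if "u \<in> V" "v \<in> V" for u v
    proof -
      have "(\<Sum>i\<in>I. \<bar>\<psi> i u - \<psi> i v\<bar>) \<le>
          (\<Sum>i\<in>I. \<bar>\<phi> i u - \<phi> i v\<bar> + (if i = k then \<bar>s u - s v\<bar> else 0))"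
        by (rule sum_mono) (use that in \<open>auto simp: \<psi>_def\<close>)
      also have "\<dots> = (\<Sum>i\<in>I. \<bar>\<phi> i u - \<phi> i v\<bar>) + \<bar>s u - s v\<bar>"
        using fin k(2) by (simp add: sum.distrib)
      finally show ?thesis
        unfolding r_def sV[symmetric] by simp
    qed
    have "0 \<le> r \<psi> (Inr (u, v))" if uv: "u \<in> V" "v \<in> V" for u v
    proof (cases "(u \<in> S) \<noteq> (v \<in> S)")
      case True
      then have "\<epsilon> \<le> r \<phi> (Inr (u, v))"
        using uv bspec[OF S(5), of "Inr (u, v)"] unfolding crosses_def k(1) E_def pair_edges_def
        by (auto simp: pair_src_def pair_tgt_def)
      then show ?thesis
        using ruv[OF uv] True by simp
    next
      case False
      then show ?thesis
        using ruv[OF uv] feas3[OF uv] by simp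
    qed
    then have pos: "\<forall>p\<in>V \<times> V. 0 \<le> r \<psi> (Inr p)"
      by auto
    have "0 \<le> sum (r \<psi>) C" if C: "C \<subseteq> E" "even_set C" for C
    proof -
      have "r \<phi> e - (if crosses S e then if e = e0 then - \<epsilon> else \<epsilon> else 0) \<le> r \<psi> e"
        if eC: "e \<in> C" for e
      proof (cases e)
        case (Inl j)
        then have "j \<in> I"
          using subsetD[OF C(1) eC] unfolding E_def pair_edges_def by auto
        show ?thesis
        proof (cases "j = k")
          case True
          then show ?thesis
            using rk Inl k S(3) by simp
        next
          case False
          then have "\<not> crosses S e"
            using jS[OF \<open>j \<in> I\<close>] unfolding Inl crosses_def by (simp add: pair_src_def pair_tgt_def)
          then show ?thesis
            using rj[OF False] Inl by simp
        qed
      next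
        case (Inr p)
        then obtain u v where "e = Inr (u, v)" "u \<in> V" "v \<in> V"
          using subsetD[OF C(1) eC] unfolding E_def pair_edges_def by auto
        then show ?thesis
          using ruv[of u v] k(1) unfolding crosses_def
          by (auto simp: pair_src_def pair_tgt_def split: if_splits)
      qed
      then have "(\<Sum>e\<in>C. r \<phi> e - (if crosses S e then if e = e0 then - \<epsilon> else \<epsilon> else 0)) \<le> sum (r \<psi>) C"
        by (rule sum_mono)
      then show ?thesis
        using red C by (meson order_trans)
    qed
    moreover have "\<psi> i (xs j) = \<psi> i (ys j)" if "i \<in> I" "j \<in> I" "i \<noteq> j" for i j
      using feas1[OF that] jS[OF that(2)] that inV[OF that(2)] unfolding \<psi>_def s_def by auto
    moreover have "r \<psi> (Inl j) \<le> 0" if "j \<in> I" for j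
      using rk rj[of j] feas2[OF that] S(4) k(1) by (cases "j = k") auto
    ultimately have "\<psi> \<in> feas"
      using pos unfolding feas_def by auto
    moreover have "\<psi> \<in> box"
      unfolding box_def mem_Collect_eq
    proof (intro allI)
      fix i u
      have bx: "\<bar>\<phi> i u\<bar> \<le> dist u z"
        using \<phi>(1) unfolding box_def by auto
      show "\<bar>\<psi> i u\<bar> \<le> dist u z"
      proof (cases "i = k \<and> u \<in> V")
        case True
        have "\<bar>\<phi> k z\<bar> \<le> dist z z"
          using \<phi>(1) unfolding box_def by blast
        then have "\<psi> k z = 0"
          unfolding \<psi>_def s_def by simp
        \<comment> \<open>The box bound on \<open>V\<close> follows from the packing constraint for
          the pair \<open>(u, z)\<close>.\<close>
        then have "\<bar>\<psi> i u\<bar> = \<bar>\<psi> k u - \<psi> k z\<bar>"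
          using True by simp
        also have "\<dots> \<le> (\<Sum>i\<in>I. \<bar>\<psi> i u - \<psi> i z\<bar>)"
          using fin(1) k(2) by (intro member_le_sum) auto
        also have "\<dots> \<le> dist u z"
          using pos True V(1) unfolding r_def by auto
        finally show ?thesis .
      next
        case False
        then show ?thesis
          using bx unfolding \<psi>_def by auto
      qed
    qed
    ultimately have "gain \<psi> \<le> gain \<phi>"
      using \<phi>(2) by blast
    moreover have "gain \<psi> = gain \<phi> + \<epsilon>"
    proof -
      have "\<psi> i (xs i) - \<psi> i (ys i) = (\<phi> i (xs i) - \<phi> i (ys i)) + (if i = k then \<epsilon> else 0)" for i
        using rk rj[of i] unfolding r_def by (cases "i = k") simp_all
      then show ?thesis
        unfolding gain_def using fin(1) k(2) by (simp add: sum.distrib)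
    qed
    ultimately show False
      using S(1) by simp
  qed
  have "\<forall>i\<in>I. \<forall>j\<in>I. \<phi> i (xs j) - \<phi> i (ys j) = (if i = j then dist (xs j) (ys j) else 0)"
    using tight feas1 unfolding r_def by simp
  moreover have "\<forall>u\<in>V. \<forall>v\<in>V. (\<Sum>i\<in>I. \<bar>\<phi> i u - \<phi> i v\<bar>) \<le> dist u v"
    using feas3 unfolding r_def by simp
  moreover have "\<forall>i x. \<bar>\<phi> i x\<bar> \<le> dist x z"
    using \<phi>(1) unfolding box_def by blast
  ultimately show ?thesis
    by blast
qed

section \<open>Passage to infinite families and spaces\<close>

theorem theorem3p15:
  fixes z :: "'a::metric_space" and I :: "'i set" and xs ys :: "'i \<Rightarrow> 'a"
  assumes "lip_interpolating z I xs ys"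
    and "lip_interp_const z I xs ys = 1"
  shows "\<exists>f :: 'i \<Rightarrow> 'a \<Rightarrow> real.
           (\<forall>i\<in>I. f i z = 0) \<and>
           (\<forall>i\<in>I. \<forall>j\<in>I. (f i (xs j) - f i (ys j)) / dist (xs j) (ys j) = (if i = j then 1 else 0)) \<and>
           (\<forall>x y. x \<noteq> y \<longrightarrow>
              (\<forall>F. finite F \<and> F \<subseteq> I \<longrightarrow> (\<Sum>i\<in>F. \<bar>f i x - f i y\<bar> / dist x y) \<le> 1))"
proof -
  have xy: "xs i \<noteq> ys i" if "i \<in> I" for i
    using assms(1) that unfolding lip_interpolating_def by blast
  have interp: "\<exists>K'. 1 \<le> K' \<and> K' < K \<and> interpolates_with z I xs ys K'" if "1 < K" for K
    using interp_const_1_interpolates_with[OF assms that] by metis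
  define box where "box = {\<phi> :: 'i \<Rightarrow> 'a \<Rightarrow> real. \<forall>i x. \<bar>\<phi> i x\<bar> \<le> dist x z}"
  \<comment> \<open>Closed conditions that see finitely many indices and points; compactness of
    \<open>box\<close> reduces the claim to finitely many of them.\<close>
  define sol where "sol = (\<lambda>(F, V). {\<phi> :: 'i \<Rightarrow> 'a \<Rightarrow> real.
    (\<forall>i\<in>F. \<forall>j\<in>F. \<phi> i (xs j) - \<phi> i (ys j) = (if i = j then dist (xs j) (ys j) else 0)) \<and>
    (\<forall>u\<in>V. \<forall>v\<in>V. (\<Sum>i\<in>F. \<bar>\<phi> i u - \<phi> i v\<bar>) \<le> dist u v)})"
  define dom where "dom = {(F, V). finite F \<and> F \<subseteq> I \<and> finite (V :: 'a set)}"
  have "box \<inter> (\<Inter>p\<in>dom. sol p) \<noteq> {}"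
  proof (rule compact_imp_fip_image)
    show "compact box"
      unfolding box_def by (rule compact_bounded_families)
    show "closed (sol p)" for p
      unfolding sol_def case_prod_unfold
      by (intro closed_Collect_conj closed_Collect_ball closed_Collect_eq closed_Collect_le
          continuous_intros)
    fix D assume D: "finite D" "D \<subseteq> dom"
    define F where "F = \<Union>(fst ` D)"
    \<comment> \<open>Finitely many conditions follow from the single one for the unions. The points
      added to \<open>V\<close> are those that \<open>finite_packing\<close> requires.\<close>
    define V where "V = insert z (xs ` F \<union> ys ` F \<union> \<Union>(snd ` D))"
    have D': "finite (fst p)" "fst p \<subseteq> I" "finite (snd p)" if "p \<in> D" for p
      using subsetD[OF D(2) that] unfolding dom_def by auto
    have F: "finite F" "F \<subseteq> I"
      unfolding F_def using D(1) D' by (blast intro: finite_UN_I)+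
    have V: "finite V" "z \<in> V" "xs ` F \<subseteq> V" "ys ` F \<subseteq> V"
      unfolding V_def using D(1) D' F(1) by auto
    have "0 \<le> sum (residual F xs ys (\<lambda>_ _. 0)) C"
      if "C \<subseteq> pair_edges F V" "multigraph.even_set (pair_src xs) (pair_tgt ys) C" for C
    proof (rule interpolates_with_conservative[OF xy interp])
      show "finite C"
        using that(1) F(1) V(1) finite_subset unfolding pair_edges_def by blast
      show "C \<subseteq> pair_edges I V"
        using that(1) F(2) unfolding pair_edges_def by blast
    qed (use that in auto)
    then obtain \<phi> where \<phi>: "\<phi> \<in> box" "\<phi> \<in> sol (F, V)"
      using finite_packing[OF F(1) V] unfolding box_def sol_def by blast
    have "\<phi> \<in> sol p" if "p \<in> D" for p
    proof -
      obtain F' V' where p: "p = (F', V')"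
        by (cases p)
      have "F' \<subseteq> F" "V' \<subseteq> V"
        unfolding F_def V_def using that p by force+
      moreover have "(\<Sum>i\<in>F'. \<bar>\<phi> i u - \<phi> i v\<bar>) \<le> (\<Sum>i\<in>F. \<bar>\<phi> i u - \<phi> i v\<bar>)" for u v
        by (rule sum_mono2) (use \<open>F' \<subseteq> F\<close> F(1) in auto)
      ultimately show ?thesis
        using \<phi>(2) unfolding sol_def p prod.case mem_Collect_eq by (meson order_trans subsetD)
    qed
    then show "box \<inter> (\<Inter>p\<in>D. sol p) \<noteq> {}"
      using \<phi>(1) by blast
  qed
  then obtain \<phi> where \<phi>: "\<phi> \<in> box" "\<And>F V. finite F \<Longrightarrow> F \<subseteq> I \<Longrightarrow> finite V \<Longrightarrow> \<phi> \<in> sol (F, V)"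
    unfolding dom_def by blast
  have "\<phi> i z = 0" for i
  proof -
    have "\<bar>\<phi> i z\<bar> \<le> dist z z"
      using \<phi>(1) unfolding box_def by blast
    then show ?thesis
      by simp
  qed
  moreover have "(\<phi> i (xs j) - \<phi> i (ys j)) / dist (xs j) (ys j) = (if i = j then 1 else 0)"
    if "i \<in> I" "j \<in> I" for i j
    using \<phi>(2)[of "{i, j}" "{}"] that xy[OF that(2)] unfolding sol_def by simp
  moreover have "(\<Sum>i\<in>F. \<bar>\<phi> i x - \<phi> i y\<bar> / dist x y) \<le> 1"
    if "x \<noteq> y" "finite F" "F \<subseteq> I" for x y F
    using \<phi>(2)[OF that(2,3), of "{x, y}"] that(1) unfolding sol_def
    by (simp add: sum_divide_distrib[symmetric] divide_le_eq)
  ultimately show ?thesis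
    by blast
qed

end
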